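(* Let $\mathrm{S}$ be any star metric whose leaves are the $C \ge 2$ packet colors, let $w(\mathrm{S})$ be the sum of its edge weights, let $L \ge 1$ be the minimal laxity, and let $\delta = w(\mathrm{S})/L$. If $\delta < 1$, then no deterministic or randomized online algorithm can achieve a competitive ratio better than $1 - \Omega(\sqrt{\delta})$ for the colored packet scheduling problem with transition costs given by $\mathrm{S}$. If $\delta \ge 1$, then no deterministic or randomized online algorithm can achieve a competitive ratio better than $\alpha$, for some constant $\alpha < 1$.
   Context: Colored packet scheduling with transition costs: there are $C$ colors (incoming ports), and transition costs $w(j,k) \ge 0$ for colors $j \ne k$, with $w(j,j)=0$. Packets arrive online; packet $i$ is a triple $(r_i, d_i, c_i)$ with release time $r_i \in \mathbb{N}_+$, deadline $d_i \in \mathbb{N}_+$ and color $c_i$. Time is slotted. In each time slot the switch either transmits one pending packet, is in a color-transition phase, or is idle. A scheduled packet $i$ must be transmitted in a slot in $[r_i, d_i]$, otherwise it is dropped. Between the transmission of a packet of color $j$ and the next transmitted packet of color $k \ne j$ there must be $w(j,k)$ time slots dedicated to color transition. The goal is to maximize the number of transmitted packets. $\mathrm{ALG}(\sigma)$ and $\mathrm{OPT}(\sigma)$ denote the number of packets transmitted by the online algorithm and by an optimal offline schedule on input $\sigma$. The minimal laxity of the inputs is $L = \min_i (d_i - r_i) \ge 1$. An online algorithm has competitive ratio $\rho \le 1$ if $E[\mathrm{ALG}(\sigma)] \ge \rho \cdot \mathrm{OPT}(\sigma)$ for every input $\sigma$. "No online algorithm can achieve a competitive ratio better than $1 - \Omega(f)$"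 means there is an absolute constant $c > 0$ such that for every online algorithm there is an input $\sigma$ with minimal laxity $L$ satisfying $E[\mathrm{ALG}(\sigma)] \le (1 - c f)\,\mathrm{OPT}(\sigma)$. In a star metric, each color $i$ is a leaf joined to a center by an edge of weight $w_i \ge 0$, and the transition cost from color $i$ to color $j \ne i$ is $w_i + w_j$. *)

theory Defs
  imports "HOL-Probability.Probability"
begin

datatype packet = Packet (release: nat) (deadline: nat) (color: nat)

definition laxity :: "packet \<Rightarrow> nat" where
  "laxity p = deadline p - release p"

text \<open>
  An input is listed in order of arrival, so the packets revealed by any given slot form a prefix
  and the position of a packet in the list is an identifier that carries no information
  about the future.
\<close>

definition inputs :: "nat \<Rightarrow> nat \<Rightarrow> packet list set" where
  "inputs C L =
    {\<sigma>. \<sigma> \<noteq> [] \<and> sorted (map release \<sigma>) \<and>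
        (\<forall>p\<in>set \<sigma>. 1 \<le> release p \<and> release p \<le> deadline p \<and> color p < C) \<and>
        Min (laxity ` set \<sigma>) = L}"

datatype slot_action = Idle | Transition | Transmit nat

type_synonym schedule = "nat \<Rightarrow> slot_action"

text \<open>
  The costs \<open>w j k\<close> are real numbers, so the requirement of \<open>w j k\<close> transition slots means at
  least \<open>w j k\<close> of them. There is no cost before the first transmitted packet.
\<close>

definition feasible :: "(nat \<Rightarrow> nat \<Rightarrow> real) \<Rightarrow> packet list \<Rightarrow> schedule \<Rightarrow> bool" where
  "feasible w \<sigma> s \<longleftrightarrow>
    (\<forall>t i. s t = Transmit i \<longrightarrow>
       i < length \<sigma> \<and> release (\<sigma> ! i) \<le> t \<and> t \<le> deadline (\<sigma> ! i)) \<and>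
    (\<forall>t t' i. s t = Transmit i \<and> s t' = Transmit i \<longrightarrow> t = t') \<and>
    (\<forall>t t' i j. t < t' \<and> s t = Transmit i \<and> s t' = Transmit j \<and>
       (\<forall>u k. t < u \<and> u < t' \<longrightarrow> s u \<noteq> Transmit k) \<longrightarrow>
       w (color (\<sigma> ! i)) (color (\<sigma> ! j)) \<le> real (card {u. t < u \<and> u < t' \<and> s u = Transition}))"

definition throughput :: "packet list \<Rightarrow> schedule \<Rightarrow> nat" where
  "throughput \<sigma> s = card {i. i < length \<sigma> \<and> (\<exists>t. s t = Transmit i)}"

definition OPT :: "(nat \<Rightarrow> nat \<Rightarrow> real) \<Rightarrow> packet list \<Rightarrow> nat" where
  "OPT w \<sigma> = Max (throughput \<sigma> ` {s. feasible w \<sigma> s})"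

text \<open>
  A deterministic online algorithm chooses the action of slot \<open>t\<close> from \<open>t\<close> and the packets
  released by then. Its own past actions are determined by the same data.
\<close>

type_synonym algorithm = "nat \<Rightarrow> packet list \<Rightarrow> slot_action"

definition run :: "algorithm \<Rightarrow> packet list \<Rightarrow> schedule" where
  "run A \<sigma> t = A t (filter (\<lambda>p. release p \<le> t) \<sigma>)"

definition ALG :: "algorithm \<Rightarrow> packet list \<Rightarrow> nat" where
  "ALG A \<sigma> = throughput \<sigma> (run A \<sigma>)"

definition deterministic_online ::
    "nat \<Rightarrow> (nat \<Rightarrow> nat \<Rightarrow> real) \<Rightarrow> nat \<Rightarrow> algorithm \<Rightarrow> bool" where
  "deterministic_online C w L A \<longleftrightarrow> (\<forall>\<sigma>\<in>inputs C L. feasible w \<sigma> (run A \<sigma>))"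

text \<open>A randomized online algorithm is a probability distribution over deterministic ones.\<close>

definition randomized_online ::
    "nat \<Rightarrow> (nat \<Rightarrow> nat \<Rightarrow> real) \<Rightarrow> nat \<Rightarrow> algorithm measure \<Rightarrow> bool" where
  "randomized_online C w L M \<longleftrightarrow>
    prob_space M \<and>
    (\<forall>A\<in>space M. deterministic_online C w L A) \<and>
    (\<forall>\<sigma>\<in>inputs C L. (\<lambda>A. real (ALG A \<sigma>)) \<in> borel_measurable M)"

text \<open>
  No online algorithm, deterministic or randomized, achieves a competitive ratio better than
  \<open>\<rho>\<close> on the inputs with \<open>C\<close> colors and minimal laxity \<open>L\<close>. Inputs are nonempty, so
  for \<open>L \<ge> 1\<close> the optimum is positive.
\<close>

definition no_online_algorithm_beats ::
    "nat \<Rightarrow> (nat \<Rightarrow> nat \<Rightarrow> real) \<Rightarrow> nat \<Rightarrow> real \<Rightarrow> bool" where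
  "no_online_algorithm_beats C w L \<rho> \<longleftrightarrow>
    (\<forall>A. deterministic_online C w L A \<longrightarrow>
       (\<exists>\<sigma>\<in>inputs C L. real (ALG A \<sigma>) \<le> \<rho> * real (OPT w \<sigma>))) \<and>
    (\<forall>M. randomized_online C w L M \<longrightarrow>
       (\<exists>\<sigma>\<in>inputs C L. (\<integral>A. real (ALG A \<sigma>) \<partial>M) \<le> \<rho> * real (OPT w \<sigma>)))"

definition star_cost :: "(nat \<Rightarrow> real) \<Rightarrow> nat \<Rightarrow> nat \<Rightarrow> real" where
  "star_cost e j k = (if j = k then 0 else e j + e k)"

end

theory Submission
  imports Defs
begin

text \<open>
  Two inputs that agree until slot \<open>2 H\<close> are played against each other. Both consist of \<open>H\<close>
  packets of a home color due around slot \<open>H\<close>, then \<open>2 m\<close> tightly loaded rounds, each with about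
  \<open>20 m f\<^sub>i\<close> packets of every color \<open>i\<close>, where \<open>f\<^sub>i\<close> is the rounded edge weight, the home color
  being as heavy as all others together, and finally \<open>H\<close> patient packets of the home color. On the
  calm input nothing else arrives, and every packet can be transmitted by cycling through the colors
  in each round. On the other input \<open>H\<close> further packets of the home color arrive after slot \<open>2 H\<close>, and
  staying with the home color keeps all \<open>3 H\<close> slots busy.

  Put \<open>F = \<Sum> f\<^sub>i\<close> over the colors other than home. In the calm input there is so little slack that an
  algorithm dropping fewer than \<open>m F / 2\<close> packets must, in each round, transmit the home color and at
  least half (by weight) of the others; this costs \<open>F / 2\<close> transition slots in any two successive
  rounds, hence \<open>m F / 2\<close> slots in all, which are lost on the second input. Since the inputs
  have \<open>O(m\<^sup>2 F)\<close> packets, the loss on one of them is an \<open>\<Omega>(1 / m)\<close> fraction, and laxity \<open>L\<close> is possible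
  as soon as \<open>m\<^sup>2 F \<ge> L\<close>. A distribution over algorithms is handled by adding the two inequalities
  before taking expectations.
\<close>

section \<open>Bounding the competitive ratio by means of two inputs\<close>

lemma throughput_le_length: "throughput \<sigma> s \<le> length \<sigma>"
proof -
  have "throughput \<sigma> s \<le> card {..<length \<sigma>}"
    unfolding throughput_def by (rule card_mono) auto
  then show ?thesis by simp
qed

lemma throughput_le_OPT:
  assumes "feasible w \<sigma> s"
  shows "throughput \<sigma> s \<le> OPT w \<sigma>"
  unfolding OPT_def
proof (rule Max_ge)
  show "finite (throughput \<sigma> ` {s. feasible w \<sigma> s})"
    by (rule finite_subset[of _ "{..length \<sigma>}"]) (auto simp: throughput_le_length)
qed (use assms in blast)

text \<open>If the ratio exceeded \<open>\<rho>\<close> on both inputs, adding the two inequalities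
  would contradict the bound \<open>B\<close>. For a distribution, the bound on the sum holds for
  each algorithm in the space and therefore survives integration; the input is picked only
  afterwards.\<close>

lemma no_online_algorithm_beats_two_inputs:
  assumes "\<sigma>1 \<in> inputs C L" "\<sigma>2 \<in> inputs C L"
    and sum_le: "\<And>A. deterministic_online C w L A \<Longrightarrow> real (ALG A \<sigma>1) + real (ALG A \<sigma>2) \<le> B"
    and B: "B \<le> \<rho> * (real (OPT w \<sigma>1) + real (OPT w \<sigma>2))"
  shows "no_online_algorithm_beats C w L \<rho>"
  unfolding no_online_algorithm_beats_def
proof (intro conjI allI impI)
  fix A assume "deterministic_online C w L A"
  then have "real (ALG A \<sigma>1) + real (ALG A \<sigma>2) \<le> \<rho> * real (OPT w \<sigma>1) + \<rho> * real (OPT w \<sigma>2)"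
    using sum_le B by (force simp: distrib_left)
  then have "real (ALG A \<sigma>1) \<le> \<rho> * real (OPT w \<sigma>1) \<or> real (ALG A \<sigma>2) \<le> \<rho> * real (OPT w \<sigma>2)"
    by linarith
  then show "\<exists>\<sigma>\<in>inputs C L. real (ALG A \<sigma>) \<le> \<rho> * real (OPT w \<sigma>)"
    using assms(1,2) by blast
next
  fix M assume M: "randomized_online C w L M"
  interpret prob_space M
    using M by (simp add: randomized_online_def)
  \<comment> \<open>Throughput is at most the number of packets; boundedness gives integrability,
    hence additivity of the integral.\<close>
  have int: "integrable M (\<lambda>A. real (ALG A \<sigma>))" if "\<sigma> \<in> inputs C L" for \<sigma>
    using M that
    by (intro integrable_const_bound[where B = "real (length \<sigma>)"])
       (auto simp: randomized_online_def ALG_def throughput_le_length)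
  have "(\<integral>A. real (ALG A \<sigma>1) \<partial>M) + (\<integral>A. real (ALG A \<sigma>2) \<partial>M)
      = (\<integral>A. real (ALG A \<sigma>1) + real (ALG A \<sigma>2) \<partial>M)"
    using int assms(1,2) by simp
  also have "\<dots> \<le> (\<integral>A. B \<partial>M)"
    using int assms(1,2) M sum_le by (intro integral_mono) (auto simp: randomized_online_def)
  also have "\<dots> = B"
    by (simp add: prob_space)
  also have "B \<le> \<rho> * real (OPT w \<sigma>1) + \<rho> * real (OPT w \<sigma>2)"
    using B by (simp add: distrib_left)
  finally have "(\<integral>A. real (ALG A \<sigma>1) \<partial>M) \<le> \<rho> * real (OPT w \<sigma>1) \<or>
      (\<integral>A. real (ALG A \<sigma>2) \<partial>M) \<le> \<rho> * real (OPT w \<sigma>2)"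
    by linarith
  then show "\<exists>\<sigma>\<in>inputs C L. (\<integral>A. real (ALG A \<sigma>) \<partial>M) \<le> \<rho> * real (OPT w \<sigma>)"
    using assms(1,2) by blast
qed

lemma no_online_algorithm_beats_mono:
  assumes "no_online_algorithm_beats C w L \<rho>" "\<rho> \<le> \<rho>'"
  shows "no_online_algorithm_beats C w L \<rho>'"
proof -
  have "\<rho> * real (OPT w \<sigma>) \<le> \<rho>' * real (OPT w \<sigma>)" for \<sigma>
    using assms(2) by (intro mult_right_mono) auto
  then show ?thesis
    using assms(1) unfolding no_online_algorithm_beats_def by (meson order_trans)
qed

subsection \<open>Offline schedules given by a plan\<close>

text \<open>A plan lists the content of slots 1, 2, and so on: a packet, or \<open>None\<close> for
  a transition slot. The input read off from it is ordered by transmission, so the identifier of a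
  packet is the number of packets before it in the plan.\<close>

definition packets_of :: "packet option list \<Rightarrow> packet list" where
  "packets_of pl = map the (filter (\<lambda>x. x \<noteq> None) pl)"

lemma packets_of_simps [simp]:
  "packets_of [] = []"
  "packets_of (None # xs) = packets_of xs"
  "packets_of (Some p # xs) = p # packets_of xs"
  "packets_of (xs @ ys) = packets_of xs @ packets_of ys"
  "packets_of (replicate n None) = []"
  "packets_of (map Some ps) = ps"
  "packets_of (concat xss) = concat (map packets_of xss)"
  by (auto simp: packets_of_def [abs_def] filter_concat map_concat comp_def filter_map)

definition plan_schedule :: "packet option list \<Rightarrow> schedule" where
  "plan_schedule pl t =
    (if t = 0 \<or> length pl < t then Idle
     else case pl ! (t - 1) of
       None \<Rightarrow> Transition
     | Some p \<Rightarrow> Transmit (length (packets_of (take (t - 1) pl))))"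

text \<open>All pairs are compared, not just consecutive ones, so that a concatenation can be
  checked without locating the neighbors of a packet.\<close>

definition separated :: "(nat \<Rightarrow> nat \<Rightarrow> real) \<Rightarrow> packet option list \<Rightarrow> bool" where
  "separated w pl \<longleftrightarrow>
    (\<forall>t t' p p'. t < t' \<and> t' < length pl \<and> pl ! t = Some p \<and> pl ! t' = Some p' \<longrightarrow>
      w (color p) (color p') \<le> real (t' - t - 1))"

text \<open>Position \<open>t\<close> of a plan that starts after slot \<open>a\<close> is slot \<open>a + t + 1\<close>.\<close>

definition timely :: "nat \<Rightarrow> packet option list \<Rightarrow> bool" where
  "timely a pl \<longleftrightarrow>
    (\<forall>t p. t < length pl \<and> pl ! t = Some p \<longrightarrow> release p \<le> a + Suc t \<and> a + Suc t \<le> deadline p)"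

lemma plan_scheduleD:
  assumes "plan_schedule pl t = Transmit i"
  obtains u p where "t = Suc u" "u < length pl" "pl ! u = Some p"
    "i = length (packets_of (take u pl))" "i < length (packets_of pl)" "packets_of pl ! i = p"
proof -
  from assms have t: "t \<noteq> 0" "t \<le> length pl"
    by (auto simp: plan_schedule_def split: if_splits)
  define u where "u = t - 1"
  with t have u: "t = Suc u" "u < length pl" by auto
  from assms u obtain p where p: "pl ! u = Some p" and i: "i = length (packets_of (take u pl))"
    by (auto simp: plan_schedule_def split: if_splits option.splits)
  have "pl = take u pl @ Some p # drop (Suc u) pl"
    using u p by (metis id_take_nth_drop)
  then have "packets_of pl = packets_of (take u pl) @ p # packets_of (drop (Suc u) pl)"
    by (metis packets_of_simps(3,4))
  then show thesis
    using that u p i by (auto simp: nth_append)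
qed

text \<open>Identifiers grow strictly along a plan, so no packet is sent twice and distinct entries
  count as distinct packets.\<close>

lemma packets_of_take_less:
  assumes "u < v" "v \<le> length pl" "pl ! u = Some p"
  shows "length (packets_of (take u pl)) < length (packets_of (take v pl))"
proof -
  have "take v pl = take u pl @ Some p # drop (Suc u) (take v pl)"
    using assms id_take_nth_drop[of u "take v pl"] by (simp add: min_def)
  then have "packets_of (take v pl) = packets_of (take u pl) @ p # packets_of (drop (Suc u) (take v pl))"
    by (metis packets_of_simps(3,4))
  then show ?thesis by simp
qed

lemma feasible_plan_schedule:
  assumes sep: "separated w pl" and time: "timely 0 pl"
  shows "feasible w (packets_of pl) (plan_schedule pl)"
  unfolding feasible_def
proof (intro conjI allI impI; (elim conjE)?)
  fix t i assume "plan_schedule pl t = Transmit i"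
  then show "i < length (packets_of pl)" "release (packets_of pl ! i) \<le> t"
    "t \<le> deadline (packets_of pl ! i)"
    using time by (auto elim!: plan_scheduleD simp: timely_def)
next
  fix t t' i assume "plan_schedule pl t = Transmit i" "plan_schedule pl t' = Transmit i"
  then obtain u u' p p' where u: "t = Suc u" "u < length pl" "pl ! u = Some p"
      "i = length (packets_of (take u pl))"
    and u': "t' = Suc u'" "u' < length pl" "pl ! u' = Some p'"
      "i = length (packets_of (take u' pl))"
    by (metis plan_scheduleD)
  then show "t = t'"
    using packets_of_take_less[of u u' pl p] packets_of_take_less[of u' u pl p']
    by (metis less_irrefl less_imp_le nat_neq_iff)
next
  fix t t' i j
  assume tt': "t < t'" and t: "plan_schedule pl t = Transmit i"
    and t': "plan_schedule pl t' = Transmit j"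
    and gap: "\<forall>u k. t < u \<and> u < t' \<longrightarrow> plan_schedule pl u \<noteq> Transmit k"
  from t obtain u p where u: "t = Suc u" "u < length pl" "pl ! u = Some p" "packets_of pl ! i = p"
    by (metis plan_scheduleD)
  from t' obtain u' p' where u': "t' = Suc u'" "u' < length pl" "pl ! u' = Some p'"
    "packets_of pl ! j = p'"
    by (metis plan_scheduleD)
  \<comment> \<open>Nothing is sent strictly between \<open>t\<close> and \<open>t'\<close>, so all
    these slots hold \<open>None\<close> and count as transition.\<close>
  have "{v. t < v \<and> v < t' \<and> plan_schedule pl v = Transition} = {t<..<t'}"
    using gap u u' by (fastforce simp: plan_schedule_def split: option.splits)
  moreover have "w (color p) (color p') \<le> real (u' - u - 1)"
    using sep u u' tt' by (auto simp: separated_def)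
  ultimately show "w (color (packets_of pl ! i)) (color (packets_of pl ! j))
      \<le> real (card {u. t < u \<and> u < t' \<and> plan_schedule pl u = Transition})"
    using u u' by simp
qed

lemma throughput_plan_schedule:
  "throughput (packets_of pl) (plan_schedule pl) = length (packets_of pl)"
proof -
  let ?S = "{u. u < length pl \<and> pl ! u \<noteq> None}"
  let ?f = "\<lambda>u. length (packets_of (take u pl))"
  let ?I = "{i. i < length (packets_of pl) \<and> (\<exists>t. plan_schedule pl t = Transmit i)}"
  have inj: "inj_on ?f ?S"
  proof (rule inj_onI)
    fix u v assume "u \<in> ?S" "v \<in> ?S" "?f u = ?f v"
    then show "u = v"
      using packets_of_take_less[of u v pl] packets_of_take_less[of v u pl]
      by (cases u v rule: linorder_cases) force+
  qed
  have "?f ` ?S \<subseteq> ?I"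
  proof
    fix i assume "i \<in> ?f ` ?S"
    then obtain u p where u: "u < length pl" "pl ! u = Some p" "i = ?f u" by auto
    then have "plan_schedule pl (Suc u) = Transmit i"
      by (simp add: plan_schedule_def)
    then show "i \<in> ?I"
      by (metis (mono_tags, lifting) mem_Collect_eq plan_scheduleD)
  qed
  then have "card (?f ` ?S) \<le> card ?I"
    by (rule card_mono[rotated]) simp
  moreover have "card ?S = length (packets_of pl)"
    by (simp add: packets_of_def length_filter_conv_card)
  ultimately have "length (packets_of pl) \<le> throughput (packets_of pl) (plan_schedule pl)"
    using inj by (simp add: card_image throughput_def)
  then show ?thesis
    using throughput_le_length by (simp add: le_antisym)
qed

lemma length_packets_of_le_OPT:
  assumes "separated w pl" "timely 0 pl"
  shows "length (packets_of pl) \<le> OPT w (packets_of pl)"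
  using throughput_le_OPT[OF feasible_plan_schedule[OF assms]] throughput_plan_schedule by simp

section \<open>Concatenation of plans\<close>

lemma timely_append [simp]:
  "timely a (xs @ ys) \<longleftrightarrow> timely a xs \<and> timely (a + length xs) ys"
proof
  assume *: "timely a (xs @ ys)"
  have "release p \<le> a + length xs + Suc t \<and> a + length xs + Suc t \<le> deadline p"
    if "t < length ys" "ys ! t = Some p" for t p
    using *[unfolded timely_def, rule_format, of "length xs + t" p] that by simp
  moreover have "timely a xs"
    using * by (auto simp: timely_def nth_append)
  ultimately show "timely a xs \<and> timely (a + length xs) ys"
    by (auto simp: timely_def)
next
  assume *: "timely a xs \<and> timely (a + length xs) ys"
  show "timely a (xs @ ys)"
    unfolding timely_def
  proof (intro allI impI, elim conjE)
    fix t p assume t: "t < length (xs @ ys)" "(xs @ ys) ! t = Some p"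
    show "release p \<le> a + Suc t \<and> a + Suc t \<le> deadline p"
    proof (cases "t < length xs")
      case True
      then show ?thesis using * t by (auto simp: timely_def nth_append)
    next
      case False
      with * t show ?thesis
        unfolding timely_def
        by (auto simp: nth_append dest!: spec[of _ "t - length xs"])
    qed
  qed
qed

lemma timelyI:
  assumes "\<And>p. Some p \<in> set xs \<Longrightarrow> release p \<le> Suc a \<and> a + length xs \<le> deadline p"
  shows "timely a xs"
  unfolding timely_def
proof (intro allI impI, elim conjE)
  fix t p assume "t < length xs" "xs ! t = Some p"
  then have "Some p \<in> set xs" by (metis nth_mem)
  from assms[OF this] \<open>t < length xs\<close>
  show "release p \<le> a + Suc t \<and> a + Suc t \<le> deadline p" by linarith
qed

lemma separated_infix:
  assumes "separated w (xs @ ys @ zs)"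
  shows "separated w ys"
  unfolding separated_def
proof (intro allI impI, elim conjE)
  fix t t' p p'
  assume "t < t'" "t' < length ys" "ys ! t = Some p" "ys ! t' = Some p'"
  then show "w (color p) (color p') \<le> real (t' - t - 1)"
    using assms[unfolded separated_def, rule_format, of "length xs + t" "length xs + t'" p p']
    by (auto simp: nth_append)
qed

text \<open>A margin consists of positions of the plan, occupied or not. It pays a packet's own
  share of any transition across the ends of the plan.\<close>

definition padded :: "(nat \<Rightarrow> nat) \<Rightarrow> packet option list \<Rightarrow> bool" where
  "padded g pl \<longleftrightarrow>
    (\<forall>t p. t < length pl \<and> pl ! t = Some p \<longrightarrow> g (color p) \<le> t \<and> t + g (color p) < length pl)"

definition segment :: "(nat \<Rightarrow> nat) \<Rightarrow> nat \<Rightarrow> packet list \<Rightarrow> packet option list" where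
  "segment g i ps = replicate (g i) None @ map Some ps @ replicate (g i) None"

lemma packets_of_segment [simp]: "packets_of (segment g i ps) = ps"
  by (simp add: segment_def)

lemma length_segment [simp]: "length (segment g i ps) = 2 * g i + length ps"
  by (simp add: segment_def)

lemma segment_nthD:
  assumes "segment g i ps ! t = Some p" "t < length (segment g i ps)"
  shows "p \<in> set ps" "g i \<le> t" "t < g i + length ps"
  using assms by (auto simp: segment_def nth_append split: if_splits)

lemma padded_append:
  assumes "padded g xs" "padded g ys"
  shows "padded g (xs @ ys)"
  unfolding padded_def
proof (intro allI impI, elim conjE)
  fix t p assume t: "t < length (xs @ ys)" "(xs @ ys) ! t = Some p"
  show "g (color p) \<le> t \<and> t + g (color p) < length (xs @ ys)"
  proof (cases "t < length xs")
    case True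
    then show ?thesis using assms(1) t by (fastforce simp: padded_def nth_append)
  next
    case False
    with assms(2) t show ?thesis
      unfolding padded_def by (auto simp: nth_append dest!: spec[of _ "t - length xs"])
  qed
qed

text \<open>For a pair of packets on different sides of the seam, the right margin of the first and
  the left margin of the second add up to the cost. This works because the cost is bounded by a sum
  of one share per color, as in a star.\<close>

lemma separated_append:
  assumes pad: "padded g xs" "padded g ys" and sep: "separated w xs" "separated w ys"
    and w: "\<And>j k. w j k \<le> real (g j) + real (g k)"
  shows "separated w (xs @ ys)"
  unfolding separated_def
proof (intro allI impI, elim conjE)
  fix t t' p p'
  assume tt': "t < t'" "t' < length (xs @ ys)" and
    p: "(xs @ ys) ! t = Some p" "(xs @ ys) ! t' = Some p'"
  consider "t' < length xs" | "length xs \<le> t" | "t < length xs" "length xs \<le> t'"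
    by linarith
  then show "w (color p) (color p') \<le> real (t' - t - 1)"
  proof cases
    case 1
    then show ?thesis
      using sep(1) tt' p by (auto simp: separated_def nth_append)
  next
    case 2
    then have "w (color p) (color p') \<le> real ((t' - length xs) - (t - length xs) - 1)"
      using sep(2)[unfolded separated_def, rule_format, of "t - length xs" "t' - length xs" p p'] tt' p
      by (simp add: nth_append less_diff_conv2 diff_less_mono)
    with 2 show ?thesis by simp
  next
    case 3
    then have "t + g (color p) < length xs"
      using pad(1) p by (auto simp: padded_def nth_append)
    moreover have "g (color p') \<le> t' - length xs"
      using 3 pad(2)[unfolded padded_def, rule_format, of "t' - length xs" p'] tt' p
      by (auto simp: nth_append)
    ultimately have "g (color p) + g (color p') \<le> t' - t - 1"
      using 3 by linarith
    then show ?thesis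
      using w[of "color p" "color p'"] by linarith
  qed
qed

lemma padded_segment:
  assumes "\<And>p. p \<in> set ps \<Longrightarrow> color p = i"
  shows "padded g (segment g i ps)"
  unfolding padded_def
proof (intro allI impI, elim conjE)
  fix t p assume t: "t < length (segment g i ps)" "segment g i ps ! t = Some p"
  then have "color p = i" "g i \<le> t" "t < g i + length ps"
    using assms segment_nthD[OF t(2,1)] by auto
  then show "g (color p) \<le> t \<and> t + g (color p) < length (segment g i ps)"
    by simp
qed

lemma separated_segment:
  assumes "\<And>p. p \<in> set ps \<Longrightarrow> color p = i" and "w i i \<le> 0"
  shows "separated w (segment g i ps)"
  unfolding separated_def
proof (intro allI impI, elim conjE)
  fix t t' p p'
  assume "t < t'" "t' < length (segment g i ps)"
    "segment g i ps ! t = Some p" "segment g i ps ! t' = Some p'"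
  then have "color p = i" "color p' = i"
    using assms(1) segment_nthD(1) by (metis order_less_trans)+
  then show "w (color p) (color p') \<le> real (t' - t - 1)"
    using assms(2) by simp
qed

lemma padded_separated_concat:
  assumes "\<And>xs. xs \<in> set xss \<Longrightarrow> padded g xs \<and> separated w xs"
    and "\<And>j k. w j k \<le> real (g j) + real (g k)"
  shows "padded g (concat xss) \<and> separated w (concat xss)"
  using assms
proof (induction xss)
  case Nil
  then show ?case by (simp add: padded_def separated_def)
next
  case (Cons xs xss)
  then show ?case
    using padded_append[of g xs "concat xss"] separated_append[of g xs "concat xss" w] by simp
qed

text \<open>Sending \<open>pre\<close> and then \<open>post\<close> without a break needs no
  transition. A plan would have to send \<open>mid\<close> as well, so the schedule is built
  directly.\<close>

lemma length_le_OPT_monochromatic: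
  assumes col: "\<And>p. p \<in> set (pre @ post) \<Longrightarrow> color p = h" and w: "w h h \<le> 0"
    and time: "timely 0 (map Some (pre @ post))"
  shows "length (pre @ post) \<le> OPT w (pre @ mid @ post)"
proof -
  \<comment> \<open>Translates the position among the packets sent into the position in the whole
    input.\<close>
  define idx where "idx u = (if u < length pre then u else u + length mid)" for u
  define s where "s t = (if t = 0 \<or> length (pre @ post) < t then Idle else Transmit (idx (t - 1)))" for t
  let ?\<sigma> = "pre @ mid @ post"
  have nth: "?\<sigma> ! idx u = (pre @ post) ! u" for u
    by (auto simp: idx_def nth_append)
  have len: "idx u < length ?\<sigma>" if "u < length (pre @ post)" for u
    using that by (auto simp: idx_def)
  have inj: "idx u = idx v \<longleftrightarrow> u = v" for u v
    by (auto simp: idx_def)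
  have sD: "\<exists>u. t = Suc u \<and> u < length (pre @ post) \<and> i = idx u" if "s t = Transmit i" for t i
    using that by (cases t) (auto simp: s_def split: if_splits)
  have "feasible w ?\<sigma> s"
    unfolding feasible_def
  proof (intro conjI allI impI; (elim conjE)?)
    fix t i assume "s t = Transmit i"
    then obtain u where u: "t = Suc u" "u < length (pre @ post)" "i = idx u"
      using sD by blast
    then show "i < length ?\<sigma>" "release (?\<sigma> ! i) \<le> t" "t \<le> deadline (?\<sigma> ! i)"
      using len nth time by (auto simp del: map_append timely_append simp: timely_def)
  next
    fix t t' i assume "s t = Transmit i" "s t' = Transmit i"
    then show "t = t'" using sD inj by metis
  next
    fix t t' i j assume "s t = Transmit i" "s t' = Transmit j"
    then have "color (?\<sigma> ! i) = h" "color (?\<sigma> ! j) = h"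
      using sD nth col by (metis nth_mem)+
    then show "w (color (?\<sigma> ! i)) (color (?\<sigma> ! j)) \<le> real (card {u. t < u \<and> u < t' \<and> s u = Transition})"
      using w by simp
  qed
  moreover have "length (pre @ post) \<le> throughput ?\<sigma> s"
  proof -
    have "idx ` {..<length (pre @ post)} \<subseteq> {i. i < length ?\<sigma> \<and> (\<exists>t. s t = Transmit i)}"
    proof
      fix i assume "i \<in> idx ` {..<length (pre @ post)}"
      then obtain u where u: "u < length (pre @ post)" "i = idx u" by blast
      then have "s (Suc u) = Transmit i" by (simp add: s_def)
      then show "i \<in> {i. i < length ?\<sigma> \<and> (\<exists>t. s t = Transmit i)}"
        using len u by blast
    qed
    then have "card (idx ` {..<length (pre @ post)}) \<le> throughput ?\<sigma> s"
      unfolding throughput_def by (rule card_mono[rotated]) simp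
    then show ?thesis
      using inj by (simp add: card_image inj_on_def)
  qed
  ultimately show ?thesis
    using throughput_le_OPT by (meson order_trans)
qed

subsection \<open>Transitions of a feasible schedule\<close>

definition transitions :: "schedule \<Rightarrow> nat \<Rightarrow> nat \<Rightarrow> nat" where
  "transitions s a b = card {u \<in> {a<..b}. s u = Transition}"

definition visited :: "packet list \<Rightarrow> schedule \<Rightarrow> nat \<Rightarrow> nat \<Rightarrow> nat set" where
  "visited \<sigma> s a b = {color (\<sigma> ! i) | u i. a \<le> u \<and> u \<le> b \<and> s u = Transmit i}"

lemma visited_mono:
  assumes "a' \<le> a" "b \<le> b'"
  shows "visited \<sigma> s a b \<subseteq> visited \<sigma> s a' b'"
  using assms unfolding visited_def by (blast intro: order_trans)

lemma transitions_add_le: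
  assumes "a \<le> b" "b \<le> c"
  shows "transitions s a b + transitions s b c \<le> transitions s a c"
proof -
  have "transitions s a b + transitions s b c
      = card ({u \<in> {a<..b}. s u = Transition} \<union> {u \<in> {b<..c}. s u = Transition})"
    unfolding transitions_def by (subst card_Un_disjoint) auto
  also have "\<dots> \<le> transitions s a c"
    unfolding transitions_def by (rule card_mono) (use assms in auto)
  finally show ?thesis .
qed

lemma transitions_mono:
  assumes "a' \<le> a" "b \<le> b'"
  shows "transitions s a b \<le> transitions s a' b'"
  unfolding transitions_def by (rule card_mono) (use assms in auto)

lemma finite_visited: "finite (visited \<sigma> s a b)"
proof -
  have "visited \<sigma> s a b \<subseteq> (\<lambda>u. color (\<sigma> ! (case s u of Transmit i \<Rightarrow> i | _ \<Rightarrow> 0))) ` {a..b}"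
    by (force simp: visited_def)
  then show ?thesis
    by (rule finite_subset) simp
qed

text \<open>Each color other than the starting one must be entered at least once, and the gaps
  before different transmissions are disjoint. Only the share of the color being entered is charged;
  the hypothesis on \<open>cost\<close> speaks of integers \<open>n\<close> so that shares may be
  rounded up.\<close>

lemma cost_visited_le_transitions:
  fixes cost :: "nat \<Rightarrow> nat"
  assumes feas: "feasible w \<sigma> s"
    and cost: "\<And>j k n. j \<in> color ` set \<sigma> \<Longrightarrow> k \<in> color ` set \<sigma> \<Longrightarrow> j \<noteq> k \<Longrightarrow> w j k \<le> real n \<Longrightarrow> cost k \<le> n"
    and t0: "s t0 = Transmit i0" and "t0 \<le> t"
  shows "sum cost (visited \<sigma> s t0 t - {color (\<sigma> ! i0)}) \<le> transitions s t0 t"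
  using \<open>t0 \<le> t\<close>
proof (induction t rule: less_induct)
  case (less t)
  show ?case
  proof (cases "t = t0")
    case True
    then have "visited \<sigma> s t0 t - {color (\<sigma> ! i0)} = {}"
      using t0 by (auto simp: visited_def)
    then show ?thesis by (simp only: sum.empty zero_le)
  next
    case False
    with less.prems have "t0 < t" by simp
    show ?thesis
    proof (cases "\<exists>j. s t = Transmit j")
      case False
      have "visited \<sigma> s t0 t = visited \<sigma> s t0 (t - 1)"
        using False \<open>t0 < t\<close> unfolding visited_def
        by (metis (no_types, opaque_lifting) Suc_diff_1 gr_zeroI le_Suc_eq le_SucI not_less0)
      moreover have "transitions s t0 (t - 1) \<le> transitions s t0 t"
        by (rule transitions_mono) auto
      moreover have "sum cost (visited \<sigma> s t0 (t - 1) - {color (\<sigma> ! i0)}) \<le> transitions s t0 (t - 1)"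
        by (rule less.IH) (use \<open>t0 < t\<close> in auto)
      ultimately show ?thesis by simp
    next
      case True
      then obtain j where j: "s t = Transmit j" by blast
      define S where "S = {u. t0 \<le> u \<and> u < t \<and> (\<exists>k. s u = Transmit k)}"
      have "finite S" "t0 \<in> S"
        using t0 \<open>t0 < t\<close> by (auto simp: S_def)
      \<comment> \<open>The last transmission before \<open>t\<close>; it and the one at
        \<open>t\<close> are consecutive, so feasibility bounds the gap between them.\<close>
      define v where "v = Max S"
      have "v \<in> S"
        unfolding v_def using \<open>finite S\<close> \<open>t0 \<in> S\<close> by (metis Max_in empty_iff)
      then obtain k where v: "t0 \<le> v" "v < t" "s v = Transmit k" by (auto simp: S_def)
      have last: "u \<le> v" if "t0 \<le> u" "u < t" "s u = Transmit l" for u l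
        unfolding v_def using that \<open>finite S\<close> by (intro Max_ge) (auto simp: S_def)
      have gap: "\<forall>u l. v < u \<and> u < t \<longrightarrow> s u \<noteq> Transmit l"
        using last v by (metis leD less_imp_le order_trans)
      have vis: "visited \<sigma> s t0 t = insert (color (\<sigma> ! j)) (visited \<sigma> s t0 v)"
      proof (intro equalityI subsetI)
        fix c assume "c \<in> visited \<sigma> s t0 t"
        then obtain u i where u: "c = color (\<sigma> ! i)" "t0 \<le> u" "u \<le> t" "s u = Transmit i"
          by (auto simp: visited_def)
        then show "c \<in> insert (color (\<sigma> ! j)) (visited \<sigma> s t0 v)"
          using last[of u i] j by (cases "u = t") (auto simp: visited_def)
      next
        fix c assume "c \<in> insert (color (\<sigma> ! j)) (visited \<sigma> s t0 v)"
        then show "c \<in> visited \<sigma> s t0 t"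
          using j v \<open>t0 < t\<close> visited_mono[of t0 t0 v t \<sigma> s] by (force simp: visited_def)
      qed
      have IH: "sum cost (visited \<sigma> s t0 v - {color (\<sigma> ! i0)}) \<le> transitions s t0 v"
        using less.IH v by blast
      have split: "transitions s t0 v + transitions s v t \<le> transitions s t0 t"
        using v by (intro transitions_add_le) auto
      show ?thesis
      proof (cases "color (\<sigma> ! j) = color (\<sigma> ! k)")
        case True
        then have "color (\<sigma> ! j) \<in> visited \<sigma> s t0 v"
          using v by (auto simp: visited_def)
        then show ?thesis
          using IH split vis by (simp add: insert_absorb)
      next
        case False
        have "w (color (\<sigma> ! k)) (color (\<sigma> ! j)) \<le> real (card {u. v < u \<and> u < t \<and> s u = Transition})"
          using feas v j gap unfolding feasible_def by blast
        moreover have "j < length \<sigma>" "k < length \<sigma>"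
          using feas v j unfolding feasible_def by blast+
        ultimately have "cost (color (\<sigma> ! j)) \<le> card {u. v < u \<and> u < t \<and> s u = Transition}"
          using False by (intro cost[of "color (\<sigma> ! k)"]) auto
        also have "\<dots> \<le> transitions s v t"
          unfolding transitions_def by (rule card_mono) auto
        finally have c: "cost (color (\<sigma> ! j)) \<le> transitions s v t" .
        \<comment> \<open>Only an inequality is needed: a color entered again, or the starting
          color, adds nothing on the left.\<close>
        have "sum cost (visited \<sigma> s t0 t - {color (\<sigma> ! i0)})
            \<le> sum cost (insert (color (\<sigma> ! j)) (visited \<sigma> s t0 v - {color (\<sigma> ! i0)}))"
          unfolding vis by (rule sum_mono2) (auto simp: finite_visited)
        also have "\<dots> \<le> cost (color (\<sigma> ! j)) + sum cost (visited \<sigma> s t0 v - {color (\<sigma> ! i0)})"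
          using finite_visited[of \<sigma> s t0 v] by (simp add: sum.insert_if)
        finally show ?thesis
          using c IH split by linarith
      qed
    qed
  qed
qed

text \<open>Every transmitted packet has a slot of its own among \<open>1..N\<close>, and none of
  these is a transition slot.\<close>

lemma throughput_add_transitions_le:
  assumes "feasible w \<sigma> s" and "\<And>p. p \<in> set \<sigma> \<Longrightarrow> 1 \<le> release p \<and> deadline p \<le> N"
  shows "throughput \<sigma> s + transitions s 0 N \<le> N"
proof -
  let ?X = "{u \<in> {0<..N}. s u = Transition}"
  have "{i. i < length \<sigma> \<and> (\<exists>t. s t = Transmit i)}
      \<subseteq> (\<lambda>t. case s t of Transmit i \<Rightarrow> i | _ \<Rightarrow> 0) ` ({0<..N} - ?X)" (is "?I \<subseteq> ?f ` _")
  proof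
    fix i assume "i \<in> ?I"
    then obtain t where t: "i < length \<sigma>" "s t = Transmit i" by blast
    then have "release (\<sigma> ! i) \<le> t" "t \<le> deadline (\<sigma> ! i)" 
      using assms(1) by (auto simp: feasible_def)
    then have "t \<in> {0<..N} - ?X"
      using assms(2)[of "\<sigma> ! i"] t by auto
    with t show "i \<in> ?f ` ({0<..N} - ?X)"
      by (intro image_eqI[of _ _ t]) auto
  qed
  then have "throughput \<sigma> s \<le> card (?f ` ({0<..N} - ?X))"
    unfolding throughput_def by (rule card_mono[rotated]) simp
  also have "\<dots> \<le> card ({0<..N} - ?X)"
    by (rule card_image_le) simp
  also have "\<dots> = N - transitions s 0 N"
    unfolding transitions_def by (subst card_Diff_subset) auto
  finally have "throughput \<sigma> s \<le> N - transitions s 0 N" .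
  moreover have "transitions s 0 N \<le> card {0<..N}"
    unfolding transitions_def by (rule card_mono) auto
  ultimately show ?thesis by simp
qed

text \<open>At most \<open>N\<close> packets satisfying \<open>Q\<close> can be sent, so the others
  are among the dropped ones; the inequality is arranged to avoid subtraction.\<close>

lemma early_packets_le:
  assumes feas: "feasible w \<sigma> s" and "\<And>p. p \<in> set \<sigma> \<Longrightarrow> 1 \<le> release p"
    and early: "\<And>i t. i < length \<sigma> \<Longrightarrow> Q (\<sigma> ! i) \<Longrightarrow> s t = Transmit i \<Longrightarrow> t \<le> N"
  shows "length (filter Q \<sigma>) + throughput \<sigma> s \<le> N + length \<sigma>"
proof -
  let ?Q = "{i. i < length \<sigma> \<and> Q (\<sigma> ! i)}" and ?S = "{i. i < length \<sigma> \<and> (\<exists>t. s t = Transmit i)}"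
  have "?Q \<inter> ?S \<subseteq> (\<lambda>t. case s t of Transmit i \<Rightarrow> i | _ \<Rightarrow> 0) ` {0<..N}" (is "_ \<subseteq> ?f ` _")
  proof
    fix i assume i: "i \<in> ?Q \<inter> ?S"
    then obtain t where t: "s t = Transmit i" by blast
    then have "release (\<sigma> ! i) \<le> t" using feas by (auto simp: feasible_def)
    moreover have "1 \<le> release (\<sigma> ! i)" "t \<le> N"
      using i t assms(2)[of "\<sigma> ! i"] early by auto
    ultimately show "i \<in> ?f ` {0<..N}"
      using t by (intro image_eqI[of _ _ t]) auto
  qed
  then have "card (?Q \<inter> ?S) \<le> card (?f ` {0<..N})"
    by (rule card_mono[rotated]) simp
  also have "\<dots> \<le> N"
    using card_image_le[of "{0<..N}" ?f] by simp
  finally have "card (?Q \<inter> ?S) \<le> N" .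
  moreover have "card (?Q \<union> ?S) \<le> card {..<length \<sigma>}"
    by (rule card_mono) auto
  moreover have "card ?Q + card ?S = card (?Q \<union> ?S) + card (?Q \<inter> ?S)"
    by (rule card_Un_Int) auto
  ultimately show ?thesis
    by (simp add: length_filter_conv_card throughput_def)
qed

lemma length_filter_concat_upt:
  "length (filter P (concat (map f [0..<n]))) = (\<Sum>j<n. length (filter P (f j)))"
  by (induction n) auto

lemma length_concat_upt: "length (concat (map f [0..<n])) = (\<Sum>j<n. length (f j))"
  by (induction n) auto

subsection \<open>The hard instance\<close>

text \<open>The home color is \<open>h\<close>, and \<open>m\<close> counts pairs of rounds and
  fixes the relative loss at order \<open>1 / m\<close>. By \<open>e_home\<close>, the weight
  \<open>F\<close> of the other colors also covers the home edge; \<open>L_le\<close> makes the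
  instance long enough for laxity \<open>L\<close>.\<close>

locale hard_instance =
  fixes C :: nat and e :: "nat \<Rightarrow> real" and L h m :: nat
  assumes h: "h < C" and e_nonneg: "\<And>i. i < C \<Longrightarrow> 0 \<le> e i"
    and e_home: "e h \<le> (\<Sum>i\<in>{..<C} - {h}. e i)"
    and e_pos: "0 < (\<Sum>i\<in>{..<C} - {h}. e i)"
    and L_le: "real L \<le> real (m * m) * (\<Sum>i\<in>{..<C} - {h}. e i)"
    and m_pos: "0 < m"
begin

definition cost :: "nat \<Rightarrow> nat" where "cost i = nat \<lceil>e i\<rceil>"

definition F :: nat where "F = sum cost ({..<C} - {h})"

text \<open>
  Leaving \<open>pad i\<close> slots on either side of every block of color \<open>i\<close> pays for all transitions. The home
  color gets the weight of all others so that a single dominant color cannot be the only one served.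
\<close>

definition pad :: "nat \<Rightarrow> nat" where "pad i = (if i = h then F else cost i)"

text \<open>The factor 20 makes the load of half the weight outweigh all slack of the calm input
  plus the few drops permitted, in \<open>pad_unvisited_le\<close>.\<close>

definition K :: nat where "K = 20 * m"

text \<open>The length of a round: color \<open>i\<close> takes \<open>K * pad i\<close> slots for
  packets and \<open>2 * pad i\<close> for margins, and the pads sum to
  \<open>2 * F\<close>.\<close>

definition G :: nat where "G = 2 * (K + 2) * F"

text \<open>Chosen so that \<open>H\<close> slots for the prelude, a gap of \<open>F\<close>, all
  rounds and another gap of \<open>F\<close> end exactly at slot \<open>2 * H\<close>.\<close>

definition H :: nat where "H = 2 * F + 2 * m * G"

text \<open>\<open>T r\<close> is the last slot before round \<open>r\<close>.\<close>

definition T :: "nat \<Rightarrow> nat" where "T r = H + F + r * G"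

text \<open>The first packet only serves to make the minimal laxity equal to \<open>L\<close>.\<close>

definition prelude :: "packet list" where
  "prelude = Packet 1 (1 + L) h # replicate (H - 1) (Packet 1 (H + F) h)"

definition round_plan :: "nat \<Rightarrow> packet option list" where
  "round_plan r = concat (map (\<lambda>i. segment pad i (replicate (K * pad i) (Packet 1 (T (Suc r)) i))) [0..<C])"

definition rounds :: "packet option list" where
  "rounds = concat (map round_plan [0..<2 * m])"

text \<open>The late deadline allows transmission in the last third, as on the calm input, or in the
  middle third, in place of the rounds.\<close>

definition filler :: "packet list" where
  "filler = replicate H (Packet 1 (3 * H) h)"

definition calm :: "packet list" where
  "calm = prelude @ packets_of rounds @ filler"

definition overload :: "packet list" where
  "overload = replicate H (Packet (2 * H + 1) (3 * H) h)"

abbreviation w :: "nat \<Rightarrow> nat \<Rightarrow> real" where "w \<equiv> star_cost e"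

section \<open>Sizes and deadlines of the instance\<close>

lemma e_le_cost: "e i \<le> real (cost i)"
  unfolding cost_def by (rule real_nat_ceiling_ge)

lemma sum_e_le_F: "(\<Sum>i\<in>{..<C} - {h}. e i) \<le> real F"
  unfolding F_def of_nat_sum by (rule sum_mono) (rule e_le_cost)

lemma F_pos: "0 < F"
  using e_pos sum_e_le_F by linarith

lemma w_le_pad: "w j k \<le> real (pad j) + real (pad k)"
proof -
  have "e i \<le> real (pad i)" for i
    using e_le_cost e_home sum_e_le_F by (auto simp: pad_def)
  then show ?thesis by (auto simp: star_cost_def add_mono)
qed

text \<open>Slots come in integers, so covering \<open>e k\<close> already covers its ceiling; the
  nonnegative share of \<open>j\<close> is dropped.\<close>

lemma cost_le_of_w_le:
  assumes "j < C" "j \<noteq> k" "w j k \<le> real n"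
  shows "cost k \<le> n"
proof -
  have "e k \<le> real n"
    using assms e_nonneg[of j] by (simp add: star_cost_def)
  then show ?thesis
    by (simp add: cost_def nat_le_iff ceiling_le_iff)
qed

lemma sum_pad: "sum pad {..<C} = 2 * F"
proof -
  have "sum pad {..<C} = pad h + sum pad ({..<C} - {h})"
    using h by (intro sum.remove) auto
  also have "sum pad ({..<C} - {h}) = F"
    unfolding F_def by (rule sum.cong) (auto simp: pad_def)
  finally show ?thesis by (simp add: pad_def)
qed

lemma G_pos: "0 < G"
  using F_pos by (simp add: G_def)

text \<open>The rounds alone have at least \<open>m * m * F\<close> slots. Strictness matters for
  the overload packets, whose laxity is \<open>H - 1\<close>.\<close>

lemma L_less_H: "L < H"
proof -
  have "real L \<le> real (m * m) * real F"
    by (rule order_trans[OF L_le]) (intro mult_left_mono sum_e_le_F, simp)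
  then have "L \<le> m * m * F"
    by (metis of_nat_le_iff of_nat_mult)
  also have "\<dots> \<le> 2 * m * G"
    by (simp add: G_def K_def algebra_simps)
  finally show ?thesis
    using F_pos by (simp add: H_def)
qed

text \<open>A loss of order \<open>m * F\<close> is thus a fraction of order \<open>1 / m\<close> of
  the whole input.\<close>

lemma H_le: "H \<le> 90 * m * (m * F)"
proof -
  have "F \<le> m * F" "m * F \<le> m * (m * F)"
    using m_pos by auto
  moreover have "H = 2 * F + 8 * (m * F) + 80 * (m * (m * F))"
    by (simp add: H_def G_def K_def algebra_simps)
  ultimately show ?thesis by linarith
qed

lemma T_Suc: "T (Suc r) = T r + G"
  by (simp add: T_def)

lemma T_mono: "i \<le> j \<Longrightarrow> T i \<le> T j"
  by (simp add: T_def)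

lemma T_end: "T (2 * m) + F = 2 * H"
  by (simp add: T_def H_def)

lemma length_round_plan: "length (round_plan r) = G"
proof -
  have "length (round_plan r) = (\<Sum>i<C. (K + 2) * pad i)"
    unfolding round_plan_def length_concat_upt by (rule sum.cong) (auto simp: distrib_right)
  also have "\<dots> = (K + 2) * sum pad {..<C}"
    by (rule sum_distrib_left[symmetric])
  also have "\<dots> = G"
    by (simp add: sum_pad G_def)
  finally show ?thesis .
qed

lemma length_rounds: "length rounds = 2 * m * G"
  by (simp add: rounds_def length_concat_upt length_round_plan)

lemma packets_of_round_plan:
  "packets_of (round_plan r) = concat (map (\<lambda>i. replicate (K * pad i) (Packet 1 (T (Suc r)) i)) [0..<C])"
  by (simp add: round_plan_def comp_def)

lemma packets_of_rounds:
  "packets_of rounds = concat (map (\<lambda>r. packets_of (round_plan r)) [0..<2 * m])"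
  by (simp add: rounds_def comp_def)

lemma set_packets_of_round_plan:
  "p \<in> set (packets_of (round_plan r)) \<Longrightarrow> release p = 1 \<and> deadline p = T (Suc r) \<and> color p < C"
  by (auto simp: packets_of_round_plan)

lemma set_calm:
  assumes "p \<in> set calm"
  shows "release p = 1" "1 + L \<le> deadline p" "deadline p \<le> 3 * H" "color p < C"
proof -
  have "T r \<le> 3 * H \<and> 1 + L \<le> T r" if "r \<le> 2 * m" for r
  proof -
    have "T r \<le> T (2 * m)" "T 0 \<le> T r" using that by (auto intro: T_mono)
    moreover have "T 0 = H + F" by (simp add: T_def)
    ultimately show ?thesis using T_end L_less_H by linarith
  qed
  then have "release p = 1 \<and> 1 + L \<le> deadline p \<and> deadline p \<le> 3 * H \<and> color p < C"
    using assms L_less_H h F_pos T_end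
    by (fastforce simp: calm_def prelude_def filler_def packets_of_rounds H_def
        dest!: set_packets_of_round_plan)
  then show "release p = 1" "1 + L \<le> deadline p" "deadline p \<le> 3 * H" "color p < C" by auto
qed

section \<open>Admissibility and offline optima of the two inputs\<close>

lemma calm_in_inputs: "calm \<in> inputs C L"
proof -
  have "Min (laxity ` set calm) = L"
  proof (rule Min_eqI)
    show "L \<le> x" if "x \<in> laxity ` set calm" for x
      using that set_calm by (fastforce simp: laxity_def)
    show "L \<in> laxity ` set calm"
      by (rule image_eqI[of _ _ "Packet 1 (1 + L) h"])
         (auto simp: laxity_def calm_def prelude_def)
  qed simp
  moreover have "map release calm = replicate (length calm) 1"
    by (rule replicate_eqI) (auto dest: set_calm(1))
  moreover have "calm \<noteq> []"
    by (simp add: calm_def prelude_def)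
  ultimately show ?thesis
    using set_calm by (fastforce simp: inputs_def)
qed

lemma calm_overload_in_inputs: "calm @ overload \<in> inputs C L"
proof -
  have ov: "release p = 2 * H + 1 \<and> deadline p = 3 * H \<and> color p = h" if "p \<in> set overload" for p
    using that by (auto simp: overload_def)
  have "Min (laxity ` set (calm @ overload)) = L"
  proof (rule Min_eqI)
    show "L \<le> x" if "x \<in> laxity ` set (calm @ overload)" for x
      using that set_calm L_less_H by (fastforce simp: laxity_def dest: ov)
    show "L \<in> laxity ` set (calm @ overload)"
      by (rule image_eqI[of _ _ "Packet 1 (1 + L) h"])
         (auto simp: laxity_def calm_def prelude_def)
  qed simp
  moreover have "sorted (map release (calm @ overload))"
    using calm_in_inputs set_calm(1) by (auto simp: inputs_def sorted_append overload_def)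
  moreover have "calm @ overload \<noteq> []"
    by (simp add: calm_def prelude_def)
  moreover have "1 \<le> release p \<and> release p \<le> deadline p \<and> color p < C"
    if "p \<in> set (calm @ overload)" for p
    using that ov[of p] set_calm[of p] h L_less_H by auto
  ultimately show ?thesis
    by (simp add: inputs_def)
qed

lemma timely_rounds: "timely (T 0) (concat (map round_plan [0..<n]))"
proof (induction n)
  case (Suc n)
  have "timely (T n) (round_plan n)"
  proof (rule timelyI)
    fix p assume "Some p \<in> set (round_plan n)"
    then have "p \<in> set (packets_of (round_plan n))"
      by (force simp: packets_of_def)
    then show "release p \<le> Suc (T n) \<and> T n + length (round_plan n) \<le> deadline p"
      using set_packets_of_round_plan by (simp add: length_round_plan T_Suc)
  qed
  moreover have "T 0 + length (concat (map round_plan [0..<n])) = T n"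
    by (simp add: length_concat_upt length_round_plan T_def)
  ultimately show ?case using Suc.IH by simp
qed (simp add: timely_def)

lemma OPT_calm: "length calm \<le> OPT w calm"
proof -
  define pl where
    "pl = map Some prelude @ replicate F None @ rounds @ replicate F None @ map Some filler"
  have w0: "w i i \<le> 0" for i
    by (simp add: star_cost_def)
  have seg: "padded pad (segment pad i ps) \<and> separated w (segment pad i ps)"
    if "\<And>p. p \<in> set ps \<Longrightarrow> color p = i" for i ps
    using that by (auto intro!: padded_segment separated_segment w0)
  have "padded pad (round_plan r) \<and> separated w (round_plan r)" for r
    unfolding round_plan_def by (rule padded_separated_concat) (auto intro: seg[THEN conjunct1] seg[THEN conjunct2] w_le_pad)
  then have "padded pad rounds \<and> separated w rounds"
    unfolding rounds_def by (intro padded_separated_concat w_le_pad) auto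
  moreover have "padded pad (segment pad h prelude) \<and> separated w (segment pad h prelude)"
    by (rule seg) (auto simp: prelude_def)
  moreover have "padded pad (segment pad h filler) \<and> separated w (segment pad h filler)"
    by (rule seg) (auto simp: filler_def)
  ultimately have "padded pad (concat [segment pad h prelude, rounds, segment pad h filler]) \<and>
      separated w (concat [segment pad h prelude, rounds, segment pad h filler])"
    by (intro padded_separated_concat w_le_pad) auto
  \<comment> \<open>The outer margins only serve to make the prelude and the filler padded; they are
    cut off again.\<close>
  then have "separated w (replicate F None @ pl @ replicate F None)"
    by (simp add: pl_def segment_def pad_def)
  then have sep: "separated w pl"
    by (rule separated_infix)
  have len: "length prelude = H"
    using L_less_H by (simp add: prelude_def)
  \<comment> \<open>The first packet is treated apart, since its deadline \<open>1 + L\<close> may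
    precede the end of the prelude.\<close>
  have "timely 0 [Some (Packet 1 (1 + L) h)]"
    by (rule timelyI) auto
  moreover have "timely 1 (replicate (H - 1) (Some (Packet 1 (H + F) h)))"
    by (rule timelyI) auto
  ultimately have "timely 0 (map Some prelude)"
    using timely_append[of 0 "[Some (Packet 1 (1 + L) h)]" "replicate (H - 1) (Some (Packet 1 (H + F) h))"]
    by (simp add: prelude_def map_replicate)
  moreover have "timely a (replicate F None)" for a
    by (rule timelyI) auto
  moreover have "timely (H + F) rounds"
    using timely_rounds[of "2 * m"] by (simp add: rounds_def T_def)
  moreover have "timely (2 * H) (map Some filler)"
    by (rule timelyI) (auto simp: filler_def)
  moreover have "H + F + 2 * m * G + F = 2 * H"
    by (simp add: H_def)
  ultimately have "timely 0 pl"
    by (simp add: pl_def len length_rounds add.assoc mult_2)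
  with sep have "length (packets_of pl) \<le> OPT w (packets_of pl)"
    by (intro length_packets_of_le_OPT)
  then show ?thesis
    by (simp add: pl_def calm_def)
qed

text \<open>The prelude, the filler and the overload fill one third of the \<open>3 * H\<close>
  slots each, all in the home color; the rounds are skipped.\<close>

lemma OPT_calm_overload: "3 * H \<le> OPT w (calm @ overload)"
proof -
  have len: "length prelude = H"
    using L_less_H by (simp add: prelude_def)
  have "timely 0 [Some (Packet 1 (1 + L) h)]"
    by (rule timelyI) auto
  moreover have "timely 1 (replicate (H - 1) (Some (Packet 1 (H + F) h)))"
    by (rule timelyI) auto
  ultimately have "timely 0 (map Some prelude)"
    using timely_append[of 0 "[Some (Packet 1 (1 + L) h)]" "replicate (H - 1) (Some (Packet 1 (H + F) h))"]
    by (simp add: prelude_def map_replicate)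
  moreover have "timely H (map Some filler)"
    by (rule timelyI) (auto simp: filler_def)
  moreover have "timely (2 * H) (map Some overload)"
    by (rule timelyI) (auto simp: overload_def)
  moreover have "length filler = H"
    by (simp add: filler_def)
  ultimately have "timely 0 (map Some (prelude @ filler @ overload))"
    by (simp add: len mult_2)
  then have "length (prelude @ filler @ overload) \<le> OPT w (prelude @ packets_of rounds @ filler @ overload)"
    by (intro length_le_OPT_monochromatic[where h = h])
       (auto simp: prelude_def filler_def overload_def star_cost_def)
  then show ?thesis
    using len by (simp add: calm_def filler_def overload_def)
qed

text \<open>If the colors in \<open>U\<close> are not served during round \<open>r\<close>, these
  are packets that must be sent by slot \<open>T r\<close> or be dropped: the prelude, all earlier
  rounds, and the share of \<open>U\<close> in round \<open>r\<close>.\<close>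

lemma length_filter_calm_ge:
  assumes "U \<subseteq> {..<C}" "r < 2 * m"
  shows "H + r * (2 * K * F) + K * sum pad U
    \<le> length (filter (\<lambda>p. deadline p \<le> T r \<or> deadline p = T (Suc r) \<and> color p \<in> U) calm)"
proof -
  let ?Q = "\<lambda>p. deadline p \<le> T r \<or> deadline p = T (Suc r) \<and> color p \<in> U"
  let ?n = "\<lambda>j. length (filter ?Q (packets_of (round_plan j)))"
  have past: "?n j = 2 * K * F" if "j < r" for j
  proof -
    have "T (Suc j) \<le> T r" using that by (intro T_mono) simp
    then have "filter ?Q (packets_of (round_plan j)) = packets_of (round_plan j)"
      by (intro filter_True) (auto dest: set_packets_of_round_plan)
    then show ?thesis
      by (simp add: packets_of_round_plan length_concat_upt sum_distrib_left[symmetric] sum_pad)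
  qed
  \<comment> \<open>Since \<open>G\<close> is positive, packets of round \<open>r\<close> are due
    after \<open>T r\<close>, so only the second disjunct can select them.\<close>
  have "?n r = (\<Sum>i<C. if i \<in> U then K * pad i else 0)"
    unfolding packets_of_round_plan length_filter_concat_upt
    using G_pos by (intro sum.cong) (auto simp: T_Suc)
  also have "\<dots> = K * sum pad U"
    using assms(1) by (simp add: sum.If_cases Int_absorb1 sum_distrib_left)
  finally have now: "?n r = K * sum pad U" .
  have "r * (2 * K * F) + K * sum pad U = (\<Sum>j<Suc r. ?n j)"
    using past now by simp
  also have "\<dots> \<le> (\<Sum>j<2 * m. ?n j)"
    using assms(2) by (intro sum_mono2) auto
  also have "\<dots> = length (filter ?Q (packets_of rounds))"
    by (simp only: packets_of_rounds length_filter_concat_upt)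
  finally have "r * (2 * K * F) + K * sum pad U \<le> length (filter ?Q (packets_of rounds))" .
  moreover have "filter ?Q prelude = prelude"
    using L_less_H by (intro filter_True) (auto simp: prelude_def T_def)
  moreover have "length prelude = H"
    using L_less_H by (simp add: prelude_def)
  ultimately show ?thesis
    by (simp add: calm_def)
qed

lemma calm_colors: "color ` set calm \<subseteq> {..<C}"
  using set_calm(4) by auto

section \<open>Transitions forced by dropping few packets of the calm input\<close>

context
  fixes s :: schedule
  assumes feas: "feasible w calm s"
    and few_drops: "2 * (length calm - throughput calm s) < m * F"
begin

text \<open>Before round \<open>r\<close>, the slots exceed the packets due by only
  \<open>F + 4 * r * F\<close>. The packets of unserved colors must fit into this slack or be
  dropped, and each unit of their weight stands for \<open>K\<close> packets.\<close>

lemma pad_unvisited_le: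
  assumes "r < 2 * m"
  shows "2 * sum pad ({..<C} - visited calm s (Suc (T r)) (T (Suc r))) \<le> F"
proof -
  let ?U = "{..<C} - visited calm s (Suc (T r)) (T (Suc r))"
  let ?Q = "\<lambda>p. deadline p \<le> T r \<or> deadline p = T (Suc r) \<and> color p \<in> ?U"
  have "length (filter ?Q calm) + throughput calm s \<le> T r + length calm"
  proof (rule early_packets_le[OF feas])
    fix i t assume i: "i < length calm" "?Q (calm ! i)" and t: "s t = Transmit i"
    have "t \<le> deadline (calm ! i)"
      using feas t by (auto simp: feasible_def)
    show "t \<le> T r"
    proof (rule ccontr)
      assume "\<not> t \<le> T r"
      with i t \<open>t \<le> deadline (calm ! i)\<close> have "t \<le> T (Suc r)" "color (calm ! i) \<in> ?U" by auto
      moreover have "color (calm ! i) \<in> visited calm s (Suc (T r)) (T (Suc r))"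
        unfolding visited_def using t \<open>\<not> t \<le> T r\<close> \<open>t \<le> T (Suc r)\<close>
        by (intro CollectI exI[of _ t] exI[of _ i]) simp
      ultimately show False by blast
    qed
  qed (use set_calm(1) in simp)
  moreover have "H + r * (2 * K * F) + K * sum pad ?U \<le> length (filter ?Q calm)"
    by (rule length_filter_calm_ge) (use assms in auto)
  moreover have "T r = H + F + r * (2 * K * F) + 4 * (r * F)"
    by (simp add: T_def G_def algebra_simps)
  ultimately have "K * sum pad ?U \<le> F + 4 * (r * F) + (length calm - throughput calm s)"
    using throughput_le_length[of calm s] by linarith
  moreover have "F + r * F \<le> 2 * (m * F)"
    using mult_le_mono1[of "Suc r" "2 * m" F] assms by simp
  ultimately have "2 * (K * sum pad ?U) \<le> 20 * (m * F)"
    using few_drops by linarith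
  then have "m * (2 * sum pad ?U) \<le> m * F"
    by (simp add: K_def algebra_simps)
  then show ?thesis
    using m_pos by simp
qed

lemma transitions_two_rounds:
  assumes "q < m"
  shows "F \<le> 2 * transitions s (T (2 * q)) (T (2 * Suc q))"
proof -
  \<comment> \<open>The home color alone has weight \<open>F\<close>, more than the weight that may
    be missed.\<close>
  have "h \<in> visited calm s (Suc (T (2 * q))) (T (Suc (2 * q)))"
  proof (rule ccontr)
    assume "h \<notin> visited calm s (Suc (T (2 * q))) (T (Suc (2 * q)))"
    then have "pad h \<le> sum pad ({..<C} - visited calm s (Suc (T (2 * q))) (T (Suc (2 * q))))"
      using h by (intro member_le_sum) auto
    then show False
      using pad_unvisited_le[of "2 * q"] assms F_pos by (simp add: pad_def)
  qed
  then obtain u i where u: "Suc (T (2 * q)) \<le> u" "u \<le> T (Suc (2 * q))" "s u = Transmit i"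
    "color (calm ! i) = h"
    by (auto simp: visited_def)
  let ?V = "visited calm s (Suc (T (Suc (2 * q)))) (T (Suc (Suc (2 * q))))"
  let ?V' = "visited calm s u (T (Suc (Suc (2 * q))))"
  \<comment> \<open>Every other color is either missed in the second round, at total weight at most
    \<open>F / 2\<close>, or visited after \<open>u\<close>, where it must be entered from
    elsewhere.\<close>
  have "F \<le> sum cost (({..<C} - {h} - ?V) \<union> (?V' - {h}))"
    unfolding F_def
  proof (rule sum_mono2)
    have "?V \<subseteq> ?V'"
      using u by (intro visited_mono) auto
    then show "{..<C} - {h} \<subseteq> {..<C} - {h} - ?V \<union> (?V' - {h})" by blast
  qed (simp_all add: finite_visited)
  also have "\<dots> \<le> sum cost ({..<C} - {h} - ?V) + sum cost (?V' - {h})"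
    by (subst sum_Un_nat) (simp_all add: finite_visited)
  also have "sum cost ({..<C} - {h} - ?V) = sum pad ({..<C} - {h} - ?V)"
    by (rule sum.cong) (auto simp: pad_def)
  also have "\<dots> \<le> sum pad ({..<C} - ?V)"
    by (rule sum_mono2) auto
  finally have "F \<le> sum pad ({..<C} - ?V) + sum cost (?V' - {h})" by simp
  moreover have "2 * sum pad ({..<C} - ?V) \<le> F"
    using pad_unvisited_le[of "Suc (2 * q)"] assms by simp
  moreover have "sum cost (?V' - {h}) \<le> transitions s u (T (Suc (Suc (2 * q))))"
  proof -
    have "u \<le> T (Suc (Suc (2 * q)))"
      using u T_Suc[of "Suc (2 * q)"] by linarith
    with feas _ u(3) have "sum cost (?V' - {color (calm ! i)}) \<le> transitions s u (T (Suc (Suc (2 * q))))"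
      by (rule cost_visited_le_transitions) (use calm_colors in \<open>blast intro: cost_le_of_w_le\<close>)
    then show ?thesis
      unfolding u(4) .
  qed
  moreover have "transitions s u (T (Suc (Suc (2 * q)))) \<le> transitions s (T (2 * q)) (T (2 * Suc q))"
    using u by (intro transitions_mono) auto
  ultimately show ?thesis by linarith
qed

lemma transitions_all_rounds: "m * F \<le> 2 * transitions s 0 (2 * H)"
proof -
  have "q * F \<le> 2 * transitions s (T 0) (T (2 * q))" if "q \<le> m" for q
    using that
  proof (induction q)
    case (Suc q)
    then show ?case
      using transitions_two_rounds[of q]
        transitions_add_le[of "T 0" "T (2 * q)" "T (2 * Suc q)" s] T_mono[of 0 "2 * q"]
        T_mono[of "2 * q" "2 * Suc q"]
      by simp
  qed simp
  from this[of m] show ?thesis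
    using transitions_mono[of 0 "T 0" "T (2 * m)" "2 * H" s] T_end by simp
qed

end

text \<open>The algorithm either drops at least \<open>m * F / 2\<close> packets of the calm input,
  or wastes as many slots before it can tell the inputs apart.\<close>

lemma ALG_le:
  assumes "deterministic_online C w L A"
  shows "2 * ALG A calm + 2 * ALG A (calm @ overload) + m * F \<le> 2 * length calm + 6 * H"
proof -
  let ?s = "run A calm" and ?s' = "run A (calm @ overload)"
  have feas: "feasible w calm ?s" "feasible w (calm @ overload) ?s'"
    using assms calm_in_inputs calm_overload_in_inputs by (auto simp: deterministic_online_def)
  \<comment> \<open>The overload is released in slot \<open>2 * H + 1\<close>, so up to
    \<open>2 * H\<close> both runs see the same packets.\<close>
  have same: "?s t = ?s' t" if "t \<le> 2 * H" for t
    using that by (auto simp: run_def overload_def filter_replicate)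
  have "throughput (calm @ overload) ?s' + transitions ?s' 0 (3 * H) \<le> 3 * H"
    using feas(2) by (rule throughput_add_transitions_le)
      (use set_calm in \<open>auto simp: overload_def\<close>)
  moreover have "transitions ?s 0 (2 * H) = transitions ?s' 0 (2 * H)"
    unfolding transitions_def by (rule arg_cong[where f = card]) (use same in auto)
  moreover have "transitions ?s' 0 (2 * H) \<le> transitions ?s' 0 (3 * H)"
    by (rule transitions_mono) auto
  moreover have "throughput calm ?s \<le> length calm"
    by (rule throughput_le_length)
  moreover have "m * F \<le> 2 * transitions ?s 0 (2 * H)"
    if "2 * (length calm - throughput calm ?s) < m * F"
    using transitions_all_rounds[OF feas(1) that] .
  ultimately show ?thesis
    unfolding ALG_def by linarith
qed

lemma length_calm_le: "length calm \<le> 3 * H"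
proof -
  have "length (packets_of rounds) = 2 * m * (2 * K * F)"
    by (simp add: packets_of_rounds packets_of_round_plan length_concat_upt
        sum_distrib_left[symmetric] sum_pad)
  also have "\<dots> \<le> 2 * m * G"
    unfolding G_def by (intro mult_le_mono) auto
  also have "\<dots> \<le> H"
    by (simp add: H_def)
  finally show ?thesis
    using L_less_H by (simp add: calm_def prelude_def filler_def)
qed

lemma no_online_algorithm_beats_instance:
  "no_online_algorithm_beats C w L (1 - 1 / (1080 * real m))"
proof (rule no_online_algorithm_beats_two_inputs[OF calm_in_inputs calm_overload_in_inputs])
  let ?B = "real (length calm) + 3 * real H - real (m * F) / 2"
  show "real (ALG A calm) + real (ALG A (calm @ overload)) \<le> ?B"
    if "deterministic_online C w L A" for A
  proof -
    have "real (2 * ALG A calm + 2 * ALG A (calm @ overload) + m * F) \<le> real (2 * length calm + 6 * H)"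
      using ALG_le[OF that] by (simp only: of_nat_le_iff)
    then show ?thesis by simp
  qed
  \<comment> \<open>Here \<open>540 = 6 * 90\<close>; the loss is half of \<open>m * F\<close>,
    whence 1080.\<close>
  have "real (length calm + 3 * H) \<le> real (540 * m * (m * F))"
    using length_calm_le H_le by (intro of_nat_mono) linarith
  then have "real (length calm + 3 * H) / (1080 * real m) \<le> real (m * F) / 2"
    using m_pos by (simp add: field_simps)
  then have "?B \<le> (1 - 1 / (1080 * real m)) * real (length calm + 3 * H)"
    by (simp add: left_diff_distrib)
  also have "\<dots> \<le> (1 - 1 / (1080 * real m)) * (real (OPT w calm) + real (OPT w (calm @ overload)))"
  proof (rule mult_left_mono)
    show "real (length calm + 3 * H) \<le> real (OPT w calm) + real (OPT w (calm @ overload))"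
      using OPT_calm OPT_calm_overload by simp
    show "0 \<le> 1 - 1 / (1080 * real m)"
      using m_pos by (simp add: field_simps)
  qed
  finally show "?B \<le> (1 - 1 / (1080 * real m)) * (real (OPT w calm) + real (OPT w (calm @ overload)))" .
qed

end

section \<open>Choice of the home color and of \<open>m\<close>\<close>

lemma no_online_algorithm_beats_one:
  assumes "0 < C"
  shows "no_online_algorithm_beats C w L 1"
proof -
  let ?\<sigma> = "[Packet 1 (1 + L) 0]"
  have \<sigma>: "?\<sigma> \<in> inputs C L"
    using assms by (auto simp: inputs_def laxity_def)
  show ?thesis
  proof (rule no_online_algorithm_beats_two_inputs[OF \<sigma> \<sigma>, where B = "2 * real (OPT w ?\<sigma>)"])
    fix A assume "deterministic_online C w L A"
    then have "feasible w ?\<sigma> (run A ?\<sigma>)"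
      using \<sigma> unfolding deterministic_online_def by blast
    then have "ALG A ?\<sigma> \<le> OPT w ?\<sigma>"
      unfolding ALG_def by (rule throughput_le_OPT)
    then show "real (ALG A ?\<sigma>) + real (ALG A ?\<sigma>) \<le> 2 * real (OPT w ?\<sigma>)"
      by linarith
  qed simp
qed

text \<open>The factor 2 in the hypothesis on \<open>L\<close> makes up for leaving out the home
  edge, which carries at most half of the weight.\<close>

lemma no_online_algorithm_beats_star:
  assumes C: "2 \<le> C" and e: "\<And>i. i < C \<Longrightarrow> 0 \<le> e i" and m: "0 < m"
    and pos: "0 < (\<Sum>i<C. e i)" and L: "2 * real L \<le> real (m * m) * (\<Sum>i<C. e i)"
  shows "no_online_algorithm_beats C (star_cost e) L (1 - 1 / (1080 * real m))"
proof -
  \<comment> \<open>The lighter of two colors carries at most half of the total weight.\<close>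
  define h :: nat where "h = (if e 0 \<le> e 1 then 0 else 1)"
  define k :: nat where "k = 1 - h"
  have hk: "h < C" "k \<in> {..<C} - {h}" "e h \<le> e k"
    using C by (auto simp: h_def k_def)
  have "e k \<le> (\<Sum>i\<in>{..<C} - {h}. e i)"
    using hk e by (intro member_le_sum) auto
  then have home: "e h \<le> (\<Sum>i\<in>{..<C} - {h}. e i)"
    using hk by linarith
  have "(\<Sum>i<C. e i) = e h + (\<Sum>i\<in>{..<C} - {h}. e i)"
    using hk by (intro sum.remove) auto
  then have half: "(\<Sum>i<C. e i) \<le> 2 * (\<Sum>i\<in>{..<C} - {h}. e i)"
    using home by simp
  then have "2 * real L \<le> real (m * m) * (2 * (\<Sum>i\<in>{..<C} - {h}. e i))"
    using L by (meson mult_left_mono of_nat_0_le_iff order_trans)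
  then interpret hard_instance C e L h m
    using hk e m pos half home by unfold_locales auto
  show ?thesis by (rule no_online_algorithm_beats_instance)
qed

theorem theorem1:
  "\<exists>c::real. \<exists>\<alpha>::real. c > 0 \<and> \<alpha> < 1 \<and>
    (\<forall>(C::nat) (e :: nat \<Rightarrow> real) (L::nat).
       C \<ge> 2 \<and> (\<forall>i<C. e i \<ge> 0) \<and> L \<ge> 1 \<longrightarrow>
       (let \<delta> = (\<Sum>i<C. e i) / real L in
          (\<delta> < 1 \<longrightarrow> no_online_algorithm_beats C (star_cost e) L (1 - c * sqrt \<delta>)) \<and>
          (\<delta> \<ge> 1 \<longrightarrow> no_online_algorithm_beats C (star_cost e) L \<alpha>)))"
\<comment> \<open>Both constants stem from \<open>3240 = 3 * 1080\<close>: \<open>m\<close> is at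
  most \<open>3 / sqrt \<delta>\<close> for \<open>\<delta> < 1\<close>, and \<open>m = 3\<close>
  otherwise.\<close>
proof (rule exI[of _ "1 / 3240"], rule exI[of _ "3239 / 3240"], intro conjI allI impI)
  fix C L :: nat and e :: "nat \<Rightarrow> real"
  assume "C \<ge> 2 \<and> (\<forall>i<C. e i \<ge> 0) \<and> L \<ge> 1"
  then have C: "2 \<le> C" and e: "\<And>i. i < C \<Longrightarrow> 0 \<le> e i" and L: "1 \<le> L" by auto
  define W where "W = (\<Sum>i<C. e i)"
  define \<delta> where "\<delta> = W / real L"
  have "0 \<le> W"
    unfolding W_def using e by (intro sum_nonneg) auto
  have small: "no_online_algorithm_beats C (star_cost e) L (1 - 1 / 3240 * sqrt \<delta>)" if "\<delta> < 1"
  proof (cases "W = 0")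
    \<comment> \<open>With total weight 0 there is no hard instance, but the claimed ratio is then
      1.\<close>
    case True
    then show ?thesis
      using no_online_algorithm_beats_one C by (simp add: \<delta>_def)
  next
    case False
    with \<open>0 \<le> W\<close> have "0 < W" by simp
    then have "0 < \<delta>" using L by (simp add: \<delta>_def)
    \<comment> \<open>This is of order \<open>1 / sqrt \<delta>\<close>, with
      \<open>m * m * \<delta>\<close> at least 4, as the instance requires at least 2.\<close>
    define m where "m = nat \<lceil>2 / sqrt \<delta>\<rceil>"
    have m_ge: "2 / sqrt \<delta> \<le> real m"
      unfolding m_def by (rule real_nat_ceiling_ge)
    have "0 < 2 / sqrt \<delta>" using \<open>0 < \<delta>\<close> by simp
    then have "0 < m" using m_ge by linarith
    have "real m \<le> 2 / sqrt \<delta> + 1"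
      unfolding m_def using \<open>0 < 2 / sqrt \<delta>\<close> by linarith
    also have "1 \<le> 1 / sqrt \<delta>"
      using \<open>0 < \<delta>\<close> that by simp
    finally have m_le: "real m \<le> 3 / sqrt \<delta>" by simp
    have "(2 / sqrt \<delta>)\<^sup>2 \<le> (real m)\<^sup>2"
      using m_ge \<open>0 < 2 / sqrt \<delta>\<close> by (intro power_mono) auto
    then have "4 / \<delta> \<le> real (m * m)"
      using \<open>0 < \<delta>\<close> by (simp add: power_divide power2_eq_square)
    then have "4 * real L \<le> real (m * m) * W"
      using \<open>0 < W\<close> by (simp add: \<delta>_def field_simps)
    then have "no_online_algorithm_beats C (star_cost e) L (1 - 1 / (1080 * real m))"
      using C e \<open>0 < m\<close> \<open>0 < W\<close> by (intro no_online_algorithm_beats_star) (auto simp: W_def)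
    moreover have "1 - 1 / (1080 * real m) \<le> 1 - 1 / 3240 * sqrt \<delta>"
      using m_le \<open>0 < m\<close> \<open>0 < \<delta>\<close> by (simp add: field_simps)
    ultimately show ?thesis by (rule no_online_algorithm_beats_mono)
  qed
  have large: "no_online_algorithm_beats C (star_cost e) L (3239 / 3240)" if "1 \<le> \<delta>"
  proof -
    have "real L \<le> W"
      using that L by (simp add: \<delta>_def)
    then have "no_online_algorithm_beats C (star_cost e) L (1 - 1 / (1080 * real 3))"
      using C e L by (intro no_online_algorithm_beats_star) (auto simp: W_def)
    then show ?thesis by simp
  qed
  show "let \<delta> = (\<Sum>i<C. e i) / real L in
      (\<delta> < 1 \<longrightarrow> no_online_algorithm_beats C (star_cost e) L (1 - 1 / 3240 * sqrt \<delta>)) \<and>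
      (\<delta> \<ge> 1 \<longrightarrow> no_online_algorithm_beats C (star_cost e) L (3239 / 3240))"
    using small large by (simp add: Let_def \<delta>_def W_def)
qed simp_all

end
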